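(* Let $G$ be an abelian group of order $9p^{4s}$, where $p$ is a prime with $p\equiv 1\pmod 4$ and $s$ is an odd positive integer. Then there does not exist a $(9p^{4s},\ r(3p^{2s}+1),\ -3p^{2s}+r^2+3r,\ r^2+r)$-partial difference set in $G$ when $r=(3p^{2s}-3)/4$ or $r=(3p^{2s}+5)/4$.
   Context: For a finite abelian group $G$ of order $v$, a subset $D\subseteq G$ of size $k$ is a $(v,k,\lambda,\mu)$-partial difference set (PDS) if the expressions $gh^{-1}$ with $g,h\in D$, $g\ne h$, represent each non-identity element of $D$ exactly $\lambda$ times and each non-identity element of $G\setminus D$ exactly $\mu$ times. *)

theory Defs
  imports "HOL-Algebra.Group" "HOL-Computational_Algebra.Primes"
begin

definition pds :: "('a, 'b) monoid_scheme \<Rightarrow> 'a set \<Rightarrow> nat \<Rightarrow> nat \<Rightarrow> int \<Rightarrow> int \<Rightarrow> bool" where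
  "pds G D v k lam mu \<longleftrightarrow>
     finite (carrier G) \<and> card (carrier G) = v \<and>
     D \<subseteq> carrier G \<and> card D = k \<and>
     (\<forall>g \<in> carrier G. g \<noteq> \<one>\<^bsub>G\<^esub> \<longrightarrow>
        int (card {(x, y). x \<in> D \<and> y \<in> D \<and> x \<noteq> y \<and> x \<otimes>\<^bsub>G\<^esub> inv\<^bsub>G\<^esub> y = g})
          = (if g \<in> D then lam else mu))"

end

theory Submission
  imports Defs "HOL-Algebra.Sylow" "HOL-Algebra.Multiplicative_Group"
    "HOL-Library.Poly_Mapping" "HOL-Library.Multiset" "HOL-Library.Disjoint_Sets"
    "HOL-Library.Z2" "HOL-Number_Theory.Cong"
begin

text \<open>
  Write \<open>q = p\<^bsup>2s\<^esup>\<close> and \<open>Q = q\<^sup>2\<close>, so that \<open>|G| = 9Q\<close>. In the group ring, \<open>D\<close> is symmetric, avoids the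
  identity and satisfies \<open>(D - r)(D - r + 3q) = \<mu>G\<close>. For a prime \<open>t\<close>, the freshman's dream
  \<open>D\<^sup>t \<equiv> D\<^sup>(\<^sup>t\<^sup>) (mod t)\<close> therefore has two consequences: if \<open>t\<close> does not divide \<open>|G|\<close> then \<open>D\<close> is
  closed under \<open>x \<mapsto> x\<^sup>t\<close>; and for \<open>t = 3\<close> the number \<open>F(h)\<close> of \<open>x \<in> D\<close> with \<open>x\<^sup>9 = h\<close> is a multiple
  of 3 whenever \<open>h \<noteq> 1\<close>.

  Let \<open>P\<close> be the Sylow \<open>p\<close>-subgroup and \<open>u = |D \<inter> P|\<close>. If \<open>t \<equiv> 1 (mod Q)\<close> and \<open>t \<equiv> -1 (mod 9)\<close>, then
  \<open>x \<mapsto> x\<^sup>t\<close> is an involution of every fibre counted by \<open>F\<close>, whose fixed points lie in \<open>P\<close>. So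
  odd fibres meet \<open>P\<close>, and since \<open>6F - F\<^sup>2 \<le> 0\<close> for every multiple \<open>F \<noteq> 3\<close> of 3, summing over \<open>h \<noteq> 1\<close>
  gives \<open>9u \<ge> \<Sum>(6F(h) - F(h)\<^sup>2)\<close>. The right-hand side is known, because \<open>\<Sum>F(h)\<^sup>2\<close> counts the
  differences of \<open>D\<close> lying in the Sylow 3-subgroup. The same count for \<open>P\<close> and the Cauchy-Schwarz
  inequality over the nine cosets of \<open>P\<close> give \<open>9u \<le> |D| + 8r\<close>. For the two values of \<open>r\<close>, these
  bounds are incompatible.
\<close>

section \<open>The freshman's dream and powers in the group ring\<close>

lemma prime_power_add_cong:
  fixes x y :: "'r::comm_ring_1"
  assumes "prime t"
  shows "\<exists>c. (x + y) ^ t = x ^ t + y ^ t + of_nat t * c"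
proof -
  have t: "t > 0" using assms by (simp add: prime_gt_0_nat)
  let ?f = "\<lambda>k. of_nat (t choose k) * x ^ k * y ^ (t - k)"
  have split: "{..t} = insert 0 (insert t {0<..<t})" using t by auto
  have "(x + y) ^ t = (\<Sum>k\<le>t. ?f k)" by (rule binomial_ring)
  also have "\<dots> = y ^ t + x ^ t + (\<Sum>k\<in>{0<..<t}. ?f k)"
    unfolding split using t by simp
  also have "(\<Sum>k\<in>{0<..<t}. ?f k)
      = (\<Sum>k\<in>{0<..<t}. of_nat t * (of_nat ((t choose k) div t) * x ^ k * y ^ (t - k)))"
  proof (intro sum.cong refl)
    fix k assume k: "k \<in> {0<..<t}"
    then have "t dvd (t choose k)" using assms t by (intro dvd_choose_prime) auto
    then have "of_nat (t choose k) = (of_nat t * of_nat ((t choose k) div t) :: 'r)"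
      by (metis dvd_mult_div_cancel of_nat_mult)
    then show "?f k = of_nat t * (of_nat ((t choose k) div t) * x ^ k * y ^ (t - k))"
      by (simp add: mult.assoc)
  qed
  finally show ?thesis
    by (auto simp: sum_distrib_left[symmetric] add.commute)
qed

lemma prime_power_sum_cong:
  fixes f :: "'i \<Rightarrow> 'r::comm_ring_1"
  assumes "prime t" "finite S"
  shows "\<exists>c. (\<Sum>i\<in>S. f i) ^ t = (\<Sum>i\<in>S. f i ^ t) + of_nat t * c"
  using assms(2)
proof (induction S)
  case empty
  then show ?case using assms(1) by (auto simp: power_0_left prime_gt_0_nat intro: exI[of _ 0])
next
  case (insert i S)
  then obtain c where c: "(\<Sum>i\<in>S. f i) ^ t = (\<Sum>i\<in>S. f i ^ t) + of_nat t * c" by blast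
  obtain c' where c': "(f i + (\<Sum>i\<in>S. f i)) ^ t = f i ^ t + (\<Sum>i\<in>S. f i) ^ t + of_nat t * c'"
    using prime_power_add_cong[OF assms(1)] by blast
  have "(\<Sum>i\<in>insert i S. f i) ^ t = (\<Sum>i\<in>insert i S. f i ^ t) + of_nat t * (c + c')"
    using insert.hyps by (simp add: c c' algebra_simps)
  then show ?case by blast
qed

text \<open>
  The number of \<open>n\<close>-tuples over \<open>D\<close> with product \<open>g\<close>, that is, the coefficient of \<open>g\<close> in the \<open>n\<close>-th
  power of \<open>D\<close> in the group ring.
\<close>
primrec tuple_count :: "('a, 'b) monoid_scheme \<Rightarrow> 'a set \<Rightarrow> nat \<Rightarrow> 'a \<Rightarrow> int" where
  "tuple_count G D 0 g = of_bool (g = \<one>\<^bsub>G\<^esub>)"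
| "tuple_count G D (Suc n) g = (\<Sum>d\<in>D. tuple_count G D n (inv\<^bsub>G\<^esub> d \<otimes>\<^bsub>G\<^esub> g))"

context comm_group
begin

text \<open>
  There is no type of elements of \<open>G\<close> to build a group ring on, so powers are computed in the monoid
  ring of the free commutative monoid and mapped to \<open>G\<close> through \<open>mset_prod\<close>; elements outside the
  carrier are sent to the identity to make this map total.
\<close>
definition restrict_one :: "'a \<Rightarrow> 'a" where
  "restrict_one x = (if x \<in> carrier G then x else \<one>)"

lemma restrict_one_closed [simp]: "restrict_one x \<in> carrier G"
  by (simp add: restrict_one_def)

lemma restrict_one_eq [simp]: "x \<in> carrier G \<Longrightarrow> restrict_one x = x"
  by (simp add: restrict_one_def)

definition mset_prod :: "'a multiset \<Rightarrow> 'a" where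
  "mset_prod M = fold_mset (\<lambda>x y. restrict_one x \<otimes> restrict_one y) \<one> M"

lemma mset_prod_empty [simp]: "mset_prod {#} = \<one>"
  by (simp add: mset_prod_def)

lemma mset_prod_add_mset:
  "mset_prod (add_mset x M) = restrict_one x \<otimes> restrict_one (mset_prod M)"
proof -
  interpret comp_fun_commute "\<lambda>x y. restrict_one x \<otimes> restrict_one y"
    by standard (simp add: fun_eq_iff m_lcomm)
  show ?thesis by (simp add: mset_prod_def)
qed

lemma mset_prod_closed [simp]: "mset_prod M \<in> carrier G"
  by (cases M) (simp_all add: mset_prod_add_mset)

text \<open>The coefficient at \<open>g\<close> of the image of \<open>u\<close> in the group ring:
  \<open>u\<close> lies in the monoid ring over multisets, and \<open>frag_extend\<close> pushes it
  forward along \<open>mset_prod\<close>.\<close>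

definition coeff_at :: "('a multiset \<Rightarrow>\<^sub>0 int) \<Rightarrow> 'a \<Rightarrow> int" where
  "coeff_at u = Poly_Mapping.lookup (frag_extend (\<lambda>M. frag_of (mset_prod M)) u)"

lemma coeff_at_add: "coeff_at (u + w) g = coeff_at u g + coeff_at w g"
  by (simp add: coeff_at_def frag_extend_add lookup_add)

lemma coeff_at_diff: "coeff_at (u - w) g = coeff_at u g - coeff_at w g"
  by (simp add: coeff_at_def frag_extend_diff lookup_minus)

lemma coeff_at_zero [simp]: "coeff_at 0 g = 0"
  by (simp add: coeff_at_def)

lemma coeff_at_sum: "coeff_at (\<Sum>i\<in>I. u i) g = (\<Sum>i\<in>I. coeff_at (u i) g)"
  by (induction I rule: infinite_finite_induct) (simp_all add: coeff_at_add)

lemma coeff_at_of_nat_mult: "coeff_at (of_nat n * u) g = int n * coeff_at u g"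
  by (induction n) (simp_all add: coeff_at_add algebra_simps)

lemma coeff_at_single [simp]: "coeff_at (frag_of M) g = of_bool (mset_prod M = g)"
  by (auto simp: coeff_at_def)

lemma coeff_at_one [simp]: "coeff_at 1 g = of_bool (\<one> = g)"
  by (metis coeff_at_single mset_prod_empty single_one empty_neutral(1))

text \<open>Multiplying by a generator translates coefficients. By linearity single multisets
  suffice. Powers of \<open>D\<close> require no other product rule.\<close>

lemma coeff_at_single_mult:
  assumes "d \<in> carrier G" "g \<in> carrier G"
  shows "coeff_at (frag_of {#d#} * u) g = coeff_at u (inv d \<otimes> g)"
proof -
  have "Poly_Mapping.keys u \<subseteq> UNIV" by simp
  then show ?thesis
  proof (induction u rule: frag_induction)
    case zero
    then show ?case by simp
  next
    case (one M)
    have "d \<otimes> mset_prod M = g \<longleftrightarrow> mset_prod M = inv d \<otimes> g"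
      using assms by (metis inv_solve_left mset_prod_closed)
    then show ?case
      using assms by (simp add: mult_single mset_prod_add_mset)
  next
    case (diff a b)
    then show ?case by (simp add: coeff_at_diff right_diff_distrib)
  qed
qed

lemma coeff_at_power:
  assumes "D \<subseteq> carrier G" "g \<in> carrier G"
  shows "coeff_at ((\<Sum>d\<in>D. frag_of {#d#}) ^ n) g = tuple_count G D n g"
  using assms(2)
proof (induction n arbitrary: g)
  case 0
  then show ?case by auto
next
  case (Suc n)
  have "coeff_at ((\<Sum>d\<in>D. frag_of {#d#}) ^ Suc n) g
      = (\<Sum>d\<in>D. coeff_at (frag_of {#d#} * (\<Sum>d\<in>D. frag_of {#d#}) ^ n) g)"
    by (simp add: sum_distrib_right coeff_at_sum)
  also have "\<dots> = (\<Sum>d\<in>D. tuple_count G D n (inv d \<otimes> g))"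
    using assms(1) Suc by (intro sum.cong refl) (auto simp: coeff_at_single_mult subset_iff)
  finally show ?case by simp
qed

text \<open>Up to a multiple of \<open>t\<close>, the \<open>t\<close>-th power of the sum of the
  generators \<open>{#d#}\<close> is the sum of their \<open>t\<close>-th powers; both are read off
  at \<open>g\<close>.\<close>

lemma tuple_count_prime_cong:
  assumes "prime t" "finite D" "D \<subseteq> carrier G" "g \<in> carrier G"
  shows "[tuple_count G D t g = int (card {d \<in> D. d [^] t = g})] (mod int t)"
proof -
  obtain c where c: "(\<Sum>d\<in>D. frag_of {#d#}) ^ t = (\<Sum>d\<in>D. frag_of {#d#} ^ t) + of_nat t * c"
    using prime_power_sum_cong[OF assms(1,2)] by blast
  have pow: "coeff_at (frag_of {#d#} ^ n) h = of_bool (d [^] n = h)"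
    if "d \<in> carrier G" "h \<in> carrier G" for d n h
    using that(2)
  proof (induction n arbitrary: h)
    case 0
    then show ?case by simp
  next
    case (Suc n)
    have "d [^] n = inv d \<otimes> h \<longleftrightarrow> d [^] Suc n = h"
      using that(1) Suc.prems by (metis inv_solve_left nat_pow_Suc2 nat_pow_closed)
    then show ?case using Suc that(1) by (simp add: coeff_at_single_mult)
  qed
  have "tuple_count G D t g = (\<Sum>d\<in>D. of_bool (d [^] t = g)) + int t * coeff_at c g"
    using assms(3,4) by (simp add: coeff_at_power[symmetric] c coeff_at_add coeff_at_sum
      coeff_at_of_nat_mult pow subset_iff)
  also have "(\<Sum>d\<in>D. of_bool (d [^] t = g)) = int (card {d \<in> D. d [^] t = g})"
    using assms(2) by (simp add: sum.If_cases of_bool_def Int_def)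
  finally show ?thesis by (simp add: cong_def)
qed

end

section \<open>Symmetric partial difference sets: powers, multipliers and fibre moments\<close>

lemma prime_power_int_cong:
  fixes x :: int
  assumes "prime t"
  shows "[x ^ t = x] (mod int t)"
proof -
  have t: "int t > 0" using assms by (simp add: prime_gt_0_nat)
  define n where "n = nat (x mod int t)"
  have n: "[x = int n] (mod int t)" using t by (simp add: n_def cong_def)
  \<comment> \<open>Fermat's little theorem is the freshman's dream for a sum of \<open>n\<close>
    ones.\<close>
  obtain c where "(\<Sum>i\<in>{..<n}. 1::int) ^ t = (\<Sum>i\<in>{..<n}. 1 ^ t) + of_nat t * c"
    using prime_power_sum_cong[OF assms, of "{..<n}"] by blast
  then have "[int n ^ t = int n] (mod int t)" by (simp add: cong_def)
  then show ?thesis using n by (meson cong_pow cong_sym cong_trans)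
qed

text \<open>The form of a PDS used for counting. \<open>pds_imp_symmetric_pds\<close> supplies
  symmetry and \<open>one_notin\<close>; the condition \<open>x \<noteq> y\<close> disappears
  because \<open>g\<close> is not the identity.\<close>

locale symmetric_pds = comm_group G for G (structure) +
  fixes D :: "'a set" and lam mu :: int
  assumes finite_carrier: "finite (carrier G)"
    and D_subset: "D \<subseteq> carrier G"
    and one_notin: "\<one> \<notin> D"
    and inv_mem: "x \<in> D \<Longrightarrow> inv x \<in> D"
    and diff_count: "\<lbrakk>g \<in> carrier G; g \<noteq> \<one>\<rbrakk> \<Longrightarrow>
      int (card {(x, y). x \<in> D \<and> y \<in> D \<and> x \<otimes> inv y = g}) = (if g \<in> D then lam else mu)"
begin

abbreviation k :: int where "k \<equiv> int (card D)"

lemma finite_D: "finite D"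
  using D_subset finite_carrier by (rule finite_subset)

lemma D_carrier [simp]: "x \<in> D \<Longrightarrow> x \<in> carrier G"
  using D_subset by blast

lemma diff_count_eq:
  assumes "g \<in> carrier G"
  shows "int (card {(x, y). x \<in> D \<and> y \<in> D \<and> x \<otimes> inv y = g})
    = mu + (lam - mu) * of_bool (g \<in> D) + (k - mu) * of_bool (g = \<one>)"
proof (cases "g = \<one>")
  case True
  have "{(x, y). x \<in> D \<and> y \<in> D \<and> x \<otimes> inv y = \<one>} = (\<lambda>x. (x, x)) ` D"
    using inv_equality by (force simp: image_iff)
  then have "card {(x, y). x \<in> D \<and> y \<in> D \<and> x \<otimes> inv y = \<one>} = card D"
    by (simp add: card_image inj_on_def)
  then show ?thesis using True one_notin by simp
next
  case False
  then show ?thesis using diff_count[OF assms] by simp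
qed

text \<open>Since \<open>D\<close> is closed under inverses, factorizations of \<open>g\<close> over
  \<open>D\<close> correspond to differences equal to \<open>g\<close>. This is the quadratic
  equation of \<open>D\<close> in the group ring.\<close>

lemma conv_count:
  assumes "g \<in> carrier G"
  shows "(\<Sum>d\<in>D. of_bool (inv d \<otimes> g \<in> D))
    = mu + (lam - mu) * of_bool (g \<in> D) + (k - mu) * of_bool (g = \<one>)"
proof -
  have "{d \<in> D. inv d \<otimes> g \<in> D} = fst ` {(x, y). x \<in> D \<and> y \<in> D \<and> x \<otimes> inv y = g}" (is "?L = ?R")
  proof
    show "?L \<subseteq> ?R"
    proof
      fix d assume d: "d \<in> ?L"
      then have "d \<otimes> inv (inv (inv d \<otimes> g)) = g"
        using assms by (simp add: m_assoc[symmetric])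
      then have "(d, inv (inv d \<otimes> g)) \<in> {(x, y). x \<in> D \<and> y \<in> D \<and> x \<otimes> inv y = g}"
        using d inv_mem by auto
      then show "d \<in> ?R" by force
    qed
    show "?R \<subseteq> ?L"
      using inv_mem by (auto simp: m_assoc[symmetric])
  qed
  moreover have "inj_on fst {(x, y). x \<in> D \<and> y \<in> D \<and> x \<otimes> inv y = g}"
  proof (rule inj_onI)
    fix p p' assume p: "p \<in> {(x, y). x \<in> D \<and> y \<in> D \<and> x \<otimes> inv y = g}"
      and p': "p' \<in> {(x, y). x \<in> D \<and> y \<in> D \<and> x \<otimes> inv y = g}" and "fst p = fst p'"
    then obtain x y z where xyz: "p = (x, y)" "p' = (x, z)" by (cases p; cases p') auto
    then have "inv y = inv z" using p p' Units_l_cancel[of x "inv y" "inv z"] by (simp add: Units_eq)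
    then have "y = z" using p p' xyz by simp (metis D_carrier inv_inv)
    then show "p = p'" using xyz by simp
  qed
  ultimately have "card {d \<in> D. inv d \<otimes> g \<in> D} = card {(x, y). x \<in> D \<and> y \<in> D \<and> x \<otimes> inv y = g}"
    by (simp add: card_image)
  moreover have "(\<Sum>d\<in>D. of_bool (inv d \<otimes> g \<in> D)) = int (card {d \<in> D. inv d \<otimes> g \<in> D})"
    using finite_D by (simp add: sum.If_cases of_bool_def Int_def)
  ultimately show ?thesis using diff_count_eq[OF assms] by simp
qed

lemma sum_of_bool_D: "(\<Sum>g\<in>A. of_bool (g \<in> D)) = int (card (D \<inter> A))" if "finite A"
  using that by (simp add: sum.If_cases of_bool_def Int_def conj_commute)

text \<open>Summation of \<open>diff_count_eq\<close> over \<open>A\<close>. The whole carrier gives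
  the relation between the parameters; a torsion subgroup gives second moments of fibres.\<close>

lemma sum_diff_count:
  assumes "A \<subseteq> carrier G" "\<one> \<in> A"
  shows "int (card {(x, y). x \<in> D \<and> y \<in> D \<and> x \<otimes> inv y \<in> A})
    = k + mu * (int (card A) - 1) + (lam - mu) * int (card (D \<inter> A))"
proof -
  have fin: "finite A" using assms finite_carrier finite_subset by blast
  let ?S = "{(x, y). x \<in> D \<and> y \<in> D \<and> x \<otimes> inv y \<in> A}"
  have finS: "finite ?S" by (rule finite_subset[of _ "D \<times> D"]) (auto simp: finite_D)
  have "(\<Sum>g\<in>A. \<Sum>z\<in>{z \<in> ?S. (\<lambda>(x, y). x \<otimes> inv y) z = g}. 1::int) = (\<Sum>z\<in>?S. 1)"
    using fin finS by (intro sum.group) auto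
  moreover have "{z \<in> ?S. (\<lambda>(x, y). x \<otimes> inv y) z = g} = {(x, y). x \<in> D \<and> y \<in> D \<and> x \<otimes> inv y = g}"
    if "g \<in> A" for g using that by auto
  ultimately have "int (card ?S) = (\<Sum>g\<in>A. int (card {(x, y). x \<in> D \<and> y \<in> D \<and> x \<otimes> inv y = g}))"
    by simp
  also have "\<dots> = (\<Sum>g\<in>A. mu + (lam - mu) * of_bool (g \<in> D) + (k - mu) * of_bool (g = \<one>))"
    using assms by (intro sum.cong refl diff_count_eq) auto
  also have "\<dots> = int (card A) * mu + (lam - mu) * (\<Sum>g\<in>A. of_bool (g \<in> D))
      + (k - mu) * (\<Sum>g\<in>A. of_bool (g = \<one>))"
    by (simp add: sum.distrib sum_distrib_left)
  also have "(\<Sum>g\<in>A. of_bool (g = \<one>)) = (1::int)"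
    using assms fin by (simp add: of_bool_def)
  finally show ?thesis using fin by (simp add: sum_of_bool_D Int_commute algebra_simps)
qed

lemma card_D_squared: "k ^ 2 = k + mu * (int (order G) - 1) + (lam - mu) * k"
proof -
  have "{(x, y). x \<in> D \<and> y \<in> D \<and> x \<otimes> inv y \<in> carrier G} = D \<times> D" by auto
  moreover have "D \<inter> carrier G = D" using D_subset by blast
  ultimately show ?thesis
    using sum_diff_count[of "carrier G"]
    by (simp add: card_cartesian_product power2_eq_square order_def)
qed

text \<open>The span of \<open>D\<close>, the identity and the sum of all group elements is stable
  under multiplication by \<open>D\<close>: use \<open>conv_count\<close> for \<open>D\<close>
  itself, and a factor \<open>k\<close> for the sum of all elements.\<close>

lemma tuple_count_Suc:
  assumes "\<And>g. g \<in> carrier G \<Longrightarrow>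
      tuple_count G D n g = a * of_bool (g \<in> D) + b * of_bool (g = \<one>) + c"
    and "g \<in> carrier G"
  shows "tuple_count G D (Suc n) g = ((lam - mu) * a + b) * of_bool (g \<in> D)
    + (k - mu) * a * of_bool (g = \<one>) + (mu * a + k * c)"
proof -
  have one: "inv d \<otimes> g = \<one> \<longleftrightarrow> d = g" if "d \<in> D" for d
    using that assms(2) by (metis D_carrier inv_solve_left inv_closed one_closed r_one)
  have "tuple_count G D (Suc n) g
      = (\<Sum>d\<in>D. a * of_bool (inv d \<otimes> g \<in> D) + b * of_bool (inv d \<otimes> g = \<one>) + c)"
    using assms by simp
  also have "\<dots> = a * (\<Sum>d\<in>D. of_bool (inv d \<otimes> g \<in> D)) + b * (\<Sum>d\<in>D. of_bool (d = g)) + k * c"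
    by (simp add: sum.distrib sum_distrib_left one)
  also have "(\<Sum>d\<in>D. of_bool (d = g)) = (of_bool (g \<in> D) :: int)"
    using finite_D by (simp add: of_bool_def)
  finally show ?thesis by (simp add: conv_count[OF assms(2)] algebra_simps)
qed

text \<open>\<rho> and \<sigma> are the roots of the quadratic satisfied by \<open>D\<close> modulo
  the sum of all elements. The three equations are the values of the \<open>n\<close>-th power at
  the eigenvalues \<rho>, \<sigma> (where that sum vanishes) and \<open>k\<close> (where it is
  \<open>order G\<close>).\<close>

lemma tuple_count_form:
  assumes "lam - mu = \<rho> + \<sigma>" "k - mu = - (\<rho> * \<sigma>)"
  shows "\<exists>a b c. (\<forall>g\<in>carrier G. tuple_count G D n g = a * of_bool (g \<in> D) + b * of_bool (g = \<one>) + c)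
    \<and> a * \<rho> + b = \<rho> ^ n \<and> a * \<sigma> + b = \<sigma> ^ n \<and> a * k + b + c * int (order G) = k ^ n"
proof (induction n)
  case 0
  show ?case by (intro exI[of _ 0] exI[of _ 1]) auto
next
  case (Suc n)
  then obtain a b c where *: "\<And>g. g \<in> carrier G \<Longrightarrow>
      tuple_count G D n g = a * of_bool (g \<in> D) + b * of_bool (g = \<one>) + c"
    and pow: "a * \<rho> + b = \<rho> ^ n" "a * \<sigma> + b = \<sigma> ^ n" "a * k + b + c * int (order G) = k ^ n"
    by blast
  have "((lam - mu) * a + b) * \<rho> + (k - mu) * a = \<rho> ^ Suc n"
    unfolding assms by (simp add: pow(1)[symmetric] algebra_simps)
  moreover have "((lam - mu) * a + b) * \<sigma> + (k - mu) * a = \<sigma> ^ Suc n"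
    unfolding assms by (simp add: pow(2)[symmetric] algebra_simps)
  moreover have "((lam - mu) * a + b) * k + (k - mu) * a + (mu * a + k * c) * int (order G) = k ^ Suc n"
  proof -
    have "k ^ Suc n = a * k ^ 2 + b * k + k * c * int (order G)"
      by (simp add: pow(3)[symmetric] power2_eq_square algebra_simps)
    then show ?thesis unfolding card_D_squared by (simp add: algebra_simps)
  qed
  ultimately show ?case using tuple_count_Suc[OF *] by blast
qed

text \<open>Fermat's theorem at the three eigenvalues forces \<open>a = 1\<close> and
  \<open>b = c = 0\<close> modulo \<open>t\<close>, so the \<open>t\<close>-th power of
  \<open>D\<close> is congruent to \<open>D\<close>. Hence every element of \<open>D\<close> has a
  \<open>t\<close>-th root in \<open>D\<close>, and by finiteness the power map permutes
  \<open>D\<close>.\<close>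

lemma prime_multiplier:
  assumes "lam - mu = \<rho> + \<sigma>" "k - mu = - (\<rho> * \<sigma>)"
    and "prime t" "\<not> int t dvd \<rho> - \<sigma>" "\<not> t dvd order G" and "d \<in> D"
  shows "d [^] t \<in> D"
proof -
  have pt: "prime (int t)" using assms(3) by simp
  obtain a b c where *: "\<And>g. g \<in> carrier G \<Longrightarrow>
      tuple_count G D t g = a * of_bool (g \<in> D) + b * of_bool (g = \<one>) + c"
    and pow: "a * \<rho> + b = \<rho> ^ t" "a * \<sigma> + b = \<sigma> ^ t" "a * k + b + c * int (order G) = k ^ t"
    using tuple_count_form[OF assms(1,2)] by blast
  have fermat: "int t dvd x ^ t - x" for x :: int
    using prime_power_int_cong[OF assms(3)] by (simp add: cong_iff_dvd_diff)
  have "(a - 1) * (\<rho> - \<sigma>) = (\<rho> ^ t - \<rho>) - (\<sigma> ^ t - \<sigma>)"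
    by (simp add: pow(1,2)[symmetric] algebra_simps)
  then have "int t dvd (a - 1) * (\<rho> - \<sigma>)" using fermat by (metis dvd_diff)
  then have a: "int t dvd a - 1" using pt assms(4) prime_dvd_mult_iff by blast
  have "b = (\<rho> ^ t - \<rho>) - (a - 1) * \<rho>" by (simp add: pow(1)[symmetric] algebra_simps)
  then have b: "int t dvd b" using fermat a by (metis dvd_diff dvd_mult2)
  have "c * int (order G) = (k ^ t - k) - (a - 1) * k - b"
    by (simp add: pow(3)[symmetric] algebra_simps)
  then have "int t dvd c * int (order G)" using fermat a b by (metis dvd_diff dvd_mult2)
  then have c: "int t dvd c" using pt assms(5) prime_dvd_mult_iff by (metis int_dvd_int_iff)
  have "D \<subseteq> (\<lambda>d. d [^] t) ` D"
  proof
    fix g assume g: "g \<in> D"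
    have "tuple_count G D t g - 1 = (a - 1) + b * of_bool (g = \<one>) + c" using g by (simp add: *)
    moreover have "int t dvd (a - 1) + b * of_bool (g = \<one>) + c" using a b c by simp
    ultimately have "[tuple_count G D t g = 1] (mod int t)"
      unfolding cong_iff_dvd_diff by metis
    then have "[int (card {d \<in> D. d [^] t = g}) = 1] (mod int t)"
      using tuple_count_prime_cong[OF assms(3) finite_D D_subset] g by (meson D_carrier cong_sym cong_trans)
    then have "card {d \<in> D. d [^] t = g} \<noteq> 0"
      using pt by (metis cong_iff_dvd_diff cong_sym diff_zero of_nat_0 not_prime_unit)
    then have "{d \<in> D. d [^] t = g} \<noteq> {}" by force
    then show "g \<in> (\<lambda>d. d [^] t) ` D" by blast
  qed
  then have "(\<lambda>d. d [^] t) ` D = D"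
    using finite_D by (metis card_image_le card_seteq finite_imageI)
  then show ?thesis using assms(6) by blast
qed

lemma multiplier:
  assumes "lam - mu = \<rho> + \<sigma>" "k - mu = - (\<rho> * \<sigma>)"
    and "\<And>q. prime q \<Longrightarrow> int q dvd \<rho> - \<sigma> \<Longrightarrow> q dvd order G"
    and "coprime t (order G)" "t > 0" and "d \<in> D"
  shows "d [^] t \<in> D"
  using assms(4-6)
proof (induction t arbitrary: d rule: prime_divisors_induct)
  case zero
  then show ?case by simp
next
  case (unit t)
  then show ?case by (simp add: D_carrier)
next
  case (factor q t)
  have "\<not> q dvd order G"
    using factor by (metis coprime_def coprime_mult_left_iff dvd_refl not_prime_unit)
  then have "d [^] q \<in> D" 
    using prime_multiplier[OF assms(1,2) factor.hyps(1)] assms(3) factor by blast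
  then have "(d [^] q) [^] t \<in> D" using factor by (simp add: coprime_mult_left_iff)
  then show ?case using factor by (simp add: nat_pow_pow)
qed

text \<open>Modulo 3 the numbers \<rho>, \<sigma> and \<open>k\<close> agree. In the cube of
  \<open>D\<close> the coefficient of \<open>D\<close> is then \<open>3 * \<rho> ^ 2 = 0\<close>,
  the constant part is \<open>3 * mu * \<rho> = 0\<close>, and the identity gets
  \<open>- 2 * \<rho> ^ 3 = \<rho>\<close>.\<close>

lemma cube_fibre_cong:
  assumes "lam - mu = \<rho> + \<sigma>" "k - mu = - (\<rho> * \<sigma>)" "3 dvd \<rho> - \<sigma>" "3 dvd k - \<rho>"
    and "g \<in> carrier G"
  shows "[int (card {d \<in> D. d [^] (3::nat) = g}) = \<rho> * of_bool (g = \<one>)] (mod 3)"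
proof -
  have 0: "tuple_count G D 0 g = 0 * of_bool (g \<in> D) + 1 * of_bool (g = \<one>) + 0" for g by simp
  note 1 = tuple_count_Suc[OF 0]
  note 2 = tuple_count_Suc[OF 1]
  note 3 = tuple_count_Suc[OF 2 assms(5)]
  obtain x where x: "\<sigma> = \<rho> - 3 * x" using assms(3) by (metis dvd_def diff_diff_eq2 add_diff_cancel_left' )
  obtain y where y: "k = \<rho> + 3 * y" using assms(4) by (metis dvd_def diff_add_cancel add.commute)
  have "3 dvd \<rho> ^ 3 - \<rho>" using prime_power_int_cong[of 3 \<rho>] by (simp add: cong_iff_dvd_diff)
  then obtain z where z: "\<rho> ^ 3 = \<rho> + 3 * z" by (metis dvd_def diff_add_cancel add.commute)
  \<comment> \<open>The explicit quotients by 3 after substituting for \<sigma>, \<open>k\<close>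
    and \<open>\<rho> ^ 3\<close>.\<close>
  define A B C where "A = \<rho> ^ 2 - 3 * \<rho> * x + 3 * x ^ 2"
    and "B = - \<rho> - 2 * z + 3 * \<rho> ^ 2 * x - 3 * \<rho> * x ^ 2" and "C = mu * (\<rho> - x + y)"
  have A: "(\<rho> + \<sigma>) ^ 2 - \<rho> * \<sigma> = 3 * A"
    unfolding x A_def by (simp add: power2_eq_square algebra_simps)
  have "- (\<rho> * \<sigma> * (\<rho> + \<sigma>)) = - 2 * \<rho> ^ 3 + 9 * \<rho> ^ 2 * x - 9 * \<rho> * x ^ 2"
    unfolding x by (simp add: power2_eq_square power3_eq_cube algebra_simps)
  then have B: "- (\<rho> * \<sigma> * (\<rho> + \<sigma>)) = \<rho> + 3 * B"
    unfolding z B_def by (simp add: algebra_simps)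
  have C: "mu * (\<rho> + \<sigma> + k) = 3 * C"
    unfolding x y C_def by (simp add: algebra_simps)
  have "tuple_count G D 3 g = ((\<rho> + \<sigma>) ^ 2 - \<rho> * \<sigma>) * of_bool (g \<in> D)
      + (- (\<rho> * \<sigma> * (\<rho> + \<sigma>))) * of_bool (g = \<one>) + mu * (\<rho> + \<sigma> + k)"
    using 3 unfolding assms(1,2) by (simp add: numeral_3_eq_3 power2_eq_square algebra_simps)
  then have "tuple_count G D 3 g - \<rho> * of_bool (g = \<one>)
      = 3 * (A * of_bool (g \<in> D) + B * of_bool (g = \<one>) + C)"
    unfolding A B C by (simp add: algebra_simps)
  then have "[tuple_count G D 3 g = \<rho> * of_bool (g = \<one>)] (mod 3)"
    unfolding cong_iff_dvd_diff by (metis dvd_triv_left)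
  moreover have "[tuple_count G D 3 g = int (card {d \<in> D. d [^] (3::nat) = g})] (mod int 3)"
    by (rule tuple_count_prime_cong) (use finite_D D_subset assms(5) in auto)
  ultimately show ?thesis by (metis cong_sym cong_trans of_nat_numeral)
qed

lemma sum_power_fibre:
  "(\<Sum>h\<in>carrier G. int (card {d \<in> D. d [^] (e::nat) = h})) = k"
proof -
  have "(\<Sum>h\<in>carrier G. \<Sum>d\<in>{d \<in> D. d [^] e = h}. 1::int) = (\<Sum>d\<in>D. 1)"
    using finite_D finite_carrier by (intro sum.group) auto
  then show ?thesis by simp
qed

text \<open>The sum of squares counts pairs with equal \<open>e\<close>-th powers, that is, pairs
  whose difference lies in the torsion subgroup \<open>K\<close>.\<close>

lemma sum_power_fibre_squares:
  fixes e :: nat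
  defines "K \<equiv> {x \<in> carrier G. x [^] e = \<one>}"
  shows "(\<Sum>h\<in>carrier G. int (card {d \<in> D. d [^] e = h}) ^ 2)
    = k + mu * (int (card K) - 1) + (lam - mu) * int (card (D \<inter> K))"
proof -
  let ?S = "{(x, y). x \<in> D \<and> y \<in> D \<and> x \<otimes> inv y \<in> K}"
  have eq: "x \<otimes> inv y \<in> K \<longleftrightarrow> x [^] e = y [^] e" if "x \<in> D" "y \<in> D" for x y
  proof -
    have "(x \<otimes> inv y) [^] e = x [^] e \<otimes> inv (y [^] e)"
      using that by (simp add: nat_pow_distrib nat_pow_inv)
    then show ?thesis
      using that by (auto simp: K_def) (metis D_carrier inv_closed inv_equality inv_inv nat_pow_closed)
  qed
  have finS: "finite ?S" by (rule finite_subset[of _ "D \<times> D"]) (auto simp: finite_D)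
  have "(\<Sum>h\<in>carrier G. \<Sum>z\<in>{z \<in> ?S. (fst z) [^] e = h}. 1::int) = (\<Sum>z\<in>?S. 1)"
    using finite_carrier finS by (intro sum.group) auto
  moreover have "{z \<in> ?S. (fst z) [^] e = h} = {d \<in> D. d [^] e = h} \<times> {d \<in> D. d [^] e = h}" for h
    by (auto simp: eq)
  ultimately have "(\<Sum>h\<in>carrier G. int (card {d \<in> D. d [^] e = h}) ^ 2) = int (card ?S)"
    by (simp add: card_cartesian_product power2_eq_square)
  also have "\<dots> = k + mu * (int (card K) - 1) + (lam - mu) * int (card (D \<inter> K))"
    by (rule sum_diff_count) (auto simp: K_def)
  finally show ?thesis .
qed

end

section \<open>Parity under involutions, and torsion in abelian groups\<close>

lemma even_card_involution:
  assumes "\<And>x. x \<in> X \<Longrightarrow> h x \<in> X" "\<And>x. x \<in> X \<Longrightarrow> h (h x) = x" "\<And>x. x \<in> X \<Longrightarrow> h x \<noteq> x"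
  shows "even (card X)"
proof -
  \<comment> \<open>In characteristic 2 the terms at \<open>x\<close> and \<open>h x\<close>
    cancel.\<close>
  have "(\<Sum>x\<in>X. 1 :: bit) = 0"
    by (rule sum_involution_eq_0[where h = h]) (use assms in auto)
  then have "even (of_nat (card X) :: bit)" by simp
  then show ?thesis by (simp only: even_of_nat_iff)
qed

context comm_group
begin

lemma pow_exponent_cong:
  assumes "x \<in> carrier G" "x [^] (n::nat) = \<one>" "[i = j] (mod n)"
  shows "x [^] i = x [^] j"
proof -
  have "x [^] i = x [^] (i mod n)" for i
  proof -
    have "x [^] i = x [^] (n * (i div n) + i mod n)" by simp
    also have "\<dots> = (x [^] n) [^] (i div n) \<otimes> x [^] (i mod n)"
      using assms(1) by (simp add: nat_pow_mult nat_pow_pow del: mult_div_mod_eq)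
    finally show ?thesis using assms by simp
  qed
  then show ?thesis using assms(3) by (metis cong_def)
qed

lemma pow_coprime_eq_one:
  assumes "x \<in> carrier G" "x [^] (a::nat) = \<one>" "x [^] (b::nat) = \<one>" "coprime a b"
  shows "x = \<one>"
proof -
  have "ord x dvd 1"
    using assms by (metis coprime_def is_unit_gcd gcd_greatest pow_eq_id coprime_iff_gcd_eq_1)
  then show ?thesis using assms(1) by (metis nat_dvd_1_iff_1 ord_eq_1)
qed

text \<open>The kernel and \<open>H\<close> have coprime exponents, so they meet trivially and
  multiplication embeds their product in \<open>G\<close>. A Sylow subgroup as \<open>H\<close> thus
  bounds the complementary torsion.\<close>

lemma card_power_kernel_le:
  assumes "finite (carrier G)" "order G = a * b" "coprime a b" "subgroup H G" "card H = b"
  shows "card {x \<in> carrier G. x [^] a = \<one>} \<le> a"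
proof -
  let ?K = "{x \<in> carrier G. x [^] a = \<one>}"
  have HG: "H \<subseteq> carrier G" using assms(4) by (rule subgroup.subset)
  have Hpow: "y [^] b = \<one>" if "y \<in> H" for y
  proof -
    interpret H: group "G\<lparr>carrier := H\<rparr>" using assms(4) by (rule subgroup.subgroup_is_group) (rule is_group)
    have "y [^]\<^bsub>G\<lparr>carrier := H\<rparr>\<^esub> order (G\<lparr>carrier := H\<rparr>) = \<one>"
      using H.pow_order_eq_1[of y] that by simp
    then show ?thesis using assms(5) by (simp add: order_def nat_pow_consistent[symmetric])
  qed
  have "inj_on (\<lambda>(x, y). x \<otimes> y) (?K \<times> H)"
  proof (rule inj_onI, clarify)
    fix x y x' y'
    assume x: "x \<in> carrier G" "x [^] a = \<one>" and x': "x' \<in> carrier G" "x' [^] a = \<one>"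
      and y: "y \<in> H" and y': "y' \<in> H" and eq: "x \<otimes> y = x' \<otimes> y'"
    have yG: "y \<in> carrier G" "y' \<in> carrier G" using y y' HG by auto
    have "inv x' \<otimes> x = inv x' \<otimes> (x \<otimes> y) \<otimes> inv y" using x x' yG by (simp add: m_assoc)
    also have "\<dots> = y' \<otimes> inv y" unfolding eq using x' yG by (simp add: m_assoc[symmetric])
    finally have z: "inv x' \<otimes> x = y' \<otimes> inv y" .
    have "(inv x' \<otimes> x) [^] a = \<one>" using x x' by (simp add: nat_pow_distrib nat_pow_inv)
    moreover have "(y' \<otimes> inv y) [^] b = \<one>" using y y' Hpow yG by (simp add: nat_pow_distrib nat_pow_inv)
    ultimately have "inv x' \<otimes> x = \<one>" using z x x' assms(3) by (metis pow_coprime_eq_one m_closed inv_closed)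
    then have "x = x'" using x x' by (metis inv_equality inv_inv inv_closed l_inv_ex inv_unique r_inv m_comm)
    then show "x = x' \<and> y = y'" using eq x yG by simp
  qed
  then have "card (?K \<times> H) \<le> card (carrier G)"
    using assms(1) HG by (intro card_inj_on_le[where f = "\<lambda>(x, y). x \<otimes> y"]) auto
  then have "card ?K * b \<le> a * b" using assms by (simp add: card_cartesian_product order_def)
  moreover have "b > 0" using assms(1,4,5) by (metis HG card_gt_0_iff finite_subset empty_iff subgroup.one_closed)
  ultimately show ?thesis by simp
qed

end

section \<open>Fibres of power maps and bounds on the intersection with a Sylow subgroup\<close>

context symmetric_pds
begin

text \<open>The fibre splits into cube fibres over the cube roots of \<open>h\<close>. None of these
  roots is the identity, so \<open>cube_fibre_cong\<close> applies to each.\<close>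

lemma ninth_power_fibre_dvd:
  assumes "lam - mu = \<rho> + \<sigma>" "k - mu = - (\<rho> * \<sigma>)" "3 dvd \<rho> - \<sigma>" "3 dvd k - \<rho>"
    and "h \<in> carrier G" "h \<noteq> \<one>"
  shows "3 dvd int (card {d \<in> D. d [^] (9::nat) = h})"
proof -
  let ?T = "{g \<in> carrier G. g [^] (3::nat) = h}" and ?S = "{d \<in> D. d [^] (9::nat) = h}"
  have nine: "(d [^] (3::nat)) [^] (3::nat) = d [^] (9::nat)" if "d \<in> D" for d
    using that by (simp add: nat_pow_pow)
  have "(\<Sum>g\<in>?T. \<Sum>d\<in>{d \<in> ?S. d [^] (3::nat) = g}. 1::int) = (\<Sum>d\<in>?S. 1)"
    using finite_carrier finite_D by (intro sum.group) (auto simp: nine)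
  moreover have "{d \<in> ?S. d [^] (3::nat) = g} = {d \<in> D. d [^] (3::nat) = g}" if "g \<in> ?T" for g
    using that by (auto simp: nine[symmetric])
  ultimately have S: "int (card ?S) = (\<Sum>g\<in>?T. int (card {d \<in> D. d [^] (3::nat) = g}))" by simp
  have "3 dvd int (card {d \<in> D. d [^] (3::nat) = g})" if "g \<in> ?T" for g
  proof -
    have "g \<noteq> \<one>" using that assms(6) by auto
    then show ?thesis
      using cube_fibre_cong[OF assms(1-4), of g] that by (simp add: cong_0_iff)
  qed
  then show ?thesis unfolding S by (rule dvd_sum)
qed

lemma odd_ninth_power_fibre:
  assumes mult: "\<And>t d. \<lbrakk>coprime t (order G); t > 0; d \<in> D\<rbrakk> \<Longrightarrow> d [^] t \<in> D"
    and ord: "order G = 9 * Q" and cop: "coprime 9 Q"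
    and odd: "odd (card {d \<in> D. d [^] (9::nat) = h})"
  shows "\<exists>x\<in>D. x [^] Q = \<one> \<and> x [^] (9::nat) = h"
proof -
  let ?X = "{d \<in> D. d [^] (9::nat) = h}"
  \<comment> \<open>Raising to the power \<open>t\<close> inverts the 3-part of an element (8 is -1
    modulo 9) and fixes the rest.\<close>
  obtain t where t9: "[t = 8] (mod 9)" and tQ: "[t = 1] (mod Q)"
    using binary_chinese_remainder_nat[OF cop] by blast
  have t0: "t > 0" using t9 by (cases t) (auto simp: cong_def)
  have "coprime (8::nat) (Suc 8)" by (rule coprime_Suc_right_nat)
  then have "coprime t 9" using cong_imp_coprime[OF cong_sym[OF t9]] by simp
  moreover have "coprime t Q" using tQ by (metis cong_imp_coprime cong_sym coprime_1_left)
  ultimately have tord: "coprime t (order G)" using ord by simp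
  have ord1: "d [^] (9 * Q) = \<one>" if "d \<in> D" for d
    using pow_order_eq_1[of d] that ord by simp
  have "[t * t = 8 * 8] (mod 9)" using t9 by (rule cong_mult) (rule t9)
  then have "[t * t = 1] (mod 9)" by (simp add: cong_def)
  moreover have "[t * t = 1] (mod Q)" using cong_mult[OF tQ tQ] by simp
  ultimately have tt: "[t * t = 1] (mod 9 * Q)" using cop by (rule coprime_cong_mult_nat)
  \<comment> \<open>Ninth powers are unchanged by the involution, so it preserves the fibre.\<close>
  have t9Q: "[t * 9 = 9] (mod 9 * Q)"
    using tQ by (metis cong_def mult.commute mult.right_neutral mult_mod_right)
  have "\<exists>x\<in>?X. x [^] t = x"
  proof (rule ccontr)
    assume "\<not> ?thesis"
    moreover have "x [^] t \<in> ?X" "(x [^] t) [^] t = x" if "x \<in> ?X" for x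
      using that mult[OF tord t0] pow_exponent_cong[OF _ ord1 tt, of x] pow_exponent_cong[OF _ ord1 t9Q, of x]
      by (auto simp: nat_pow_pow)
    ultimately show False using odd even_card_involution[of ?X "\<lambda>x. x [^] t"] by blast
  qed
  then obtain x where x: "x \<in> D" "x [^] (9::nat) = h" "x [^] t = x" by blast
  \<comment> \<open>\<open>y\<close> carries the 3-part of the fixed point \<open>x\<close>. It is
    both fixed and inverted, so its square is trivial; with \<open>y9\<close> this makes
    \<open>y\<close> trivial.\<close>
  define y where "y = x [^] Q"
  have y: "y \<in> carrier G" using x by (simp add: y_def)
  have y9: "y [^] (9::nat) = \<one>" using ord1[OF x(1)] x by (simp add: y_def nat_pow_pow mult.commute)
  have "y [^] t = (x [^] t) [^] Q" using x(1) by (simp add: y_def nat_pow_pow mult.commute)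
  then have "y [^] (8::nat) = y" using pow_exponent_cong[OF y y9 t9] by (simp add: x(3) y_def)
  moreover have "y [^] Suc 8 = y [^] (8::nat) \<otimes> y" by (rule nat_pow_Suc)
  ultimately have "y [^] (2::nat) = \<one>" using y9 y by (simp add: numeral_2_eq_2)
  then have "y = \<one>" using y y9 by (intro pow_coprime_eq_one[of y 2 9]) auto
  then show ?thesis using x(1,2) unfolding y_def by blast
qed

lemma kernel_intersection_lower:
  assumes mult: "\<And>t d. \<lbrakk>coprime t (order G); t > 0; d \<in> D\<rbrakk> \<Longrightarrow> d [^] t \<in> D"
    and ord: "order G = 9 * Q" and cop: "coprime 9 Q"
    and dvd3: "\<And>h. \<lbrakk>h \<in> carrier G; h \<noteq> \<one>\<rbrakk> \<Longrightarrow> 3 dvd int (card {d \<in> D. d [^] (9::nat) = h})"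
    and K: "card {x \<in> carrier G. x [^] (9::nat) = \<one>} \<le> 9" and mu: "mu \<ge> 0"
  defines "d \<equiv> int (card {x \<in> D. x [^] (9::nat) = \<one>})"
  shows "6 * (k - d) - (k + 8 * mu + (lam - mu) * d - d ^ 2) \<le> 9 * int (card {x \<in> D. x [^] Q = \<one>})"
proof -
  define F where "F h = int (card {x \<in> D. x [^] (9::nat) = h})" for h
  let ?C = "carrier G - {\<one>}" and ?P = "{x \<in> D. x [^] Q = \<one>}"
  let ?T = "{h \<in> ?C. F h = 3}"
  have d: "d = F \<one>" by (simp add: d_def F_def)
  have "(\<Sum>h\<in>carrier G. F h) = k" using sum_power_fibre by (simp add: F_def)
  \<comment> \<open>The fibre over the identity, of size \<open>d\<close>, is split off:
    divisibility by 3 is only available elsewhere.\<close>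
  then have s1: "(\<Sum>h\<in>?C. F h) = k - d"
    using finite_carrier by (simp add: sum_diff1 d)
  let ?K = "{x \<in> carrier G. x [^] (9::nat) = \<one>}"
  have "D \<inter> ?K = {x \<in> D. x [^] (9::nat) = \<one>}" by auto
  then have "(\<Sum>h\<in>carrier G. F h ^ 2) = k + mu * (int (card ?K) - 1) + (lam - mu) * d"
    using sum_power_fibre_squares[of 9] by (simp add: F_def d_def)
  moreover have "mu * (int (card ?K) - 1) \<le> mu * 8" using K mu by (intro mult_left_mono) auto
  ultimately have s2: "(\<Sum>h\<in>?C. F h ^ 2) \<le> k + 8 * mu + (lam - mu) * d - d ^ 2"
    using finite_carrier by (simp add: sum_diff1 d)
  have term_le: "6 * F h - F h ^ 2 \<le> 9 * of_bool (F h = 3)" if h: "h \<in> ?C" for h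
  proof -
    obtain j where j: "F h = 3 * j" using dvd3[of h] h by (auto simp: F_def)
    \<comment> \<open>With \<open>F h = 3 * j\<close> the term is \<open>9 * j * (2 - j)\<close>,
      positive only for \<open>j = 1\<close>, where it is 9.\<close>
    have "j * (2 - j) \<le> 0" if "j \<noteq> 1"
      using that by (cases "j \<le> 0") (auto simp: mult_le_0_iff)
    moreover have "6 * F h - F h ^ 2 = 9 * (j * (2 - j))" by (simp add: j power2_eq_square algebra_simps)
    ultimately show ?thesis using j by (cases "j = 1") auto
  qed
  have "6 * (k - d) - (k + 8 * mu + (lam - mu) * d - d ^ 2) \<le> 6 * (\<Sum>h\<in>?C. F h) - (\<Sum>h\<in>?C. F h ^ 2)"
    using s1 s2 by simp
  also have "\<dots> = (\<Sum>h\<in>?C. 6 * F h - F h ^ 2)"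
    by (simp add: sum_subtractf sum_distrib_left)
  also have "\<dots> \<le> (\<Sum>h\<in>?C. 9 * of_bool (F h = 3))" by (rule sum_mono) (rule term_le)
  also have "\<dots> = 9 * int (card ?T)"
    using finite_carrier by (simp add: sum_distrib_left[symmetric] of_bool_def sum.If_cases Int_def)
  also have "card ?T \<le> card ?P"
  proof -
    have "?T \<subseteq> (\<lambda>x. x [^] (9::nat)) ` ?P"
    proof
      fix h assume "h \<in> ?T"
      then have "card {x \<in> D. x [^] (9::nat) = h} = 3" by (simp add: F_def)
      then have "odd (card {x \<in> D. x [^] (9::nat) = h})" by simp
      then show "h \<in> (\<lambda>x. x [^] (9::nat)) ` ?P"
        using odd_ninth_power_fibre[OF mult ord cop] by blast
    qed
    then show ?thesis using finite_D surj_card_le[of ?P] by auto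
  qed
  finally show ?thesis by simp
qed

text \<open>Fibres of the \<open>Q\<close>-th power map are the parts of \<open>D\<close> in cosets
  of the \<open>Q\<close>-torsion. Cauchy-Schwarz over the nontrivial cosets confines
  \<open>(a * u - k) / (a - 1)\<close> between \<sigma> and \<rho>, as in eigenvalue
  interlacing.\<close>

lemma kernel_intersection_upper:
  assumes "lam - mu = \<rho> + \<sigma>" "k - mu = - (\<rho> * \<sigma>)" "\<sigma> < \<rho>"
    and ord: "order G = a * Q" and a: "a > 1" and mu: "mu \<ge> 0"
    and Ka: "card {x \<in> carrier G. x [^] a = \<one>} \<le> a"
    and KQ: "card {x \<in> carrier G. x [^] Q = \<one>} \<le> Q"
  shows "int a * int (card {x \<in> D. x [^] Q = \<one>}) \<le> k + (int a - 1) * \<rho>"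
proof -
  define U where "U h = int (card {x \<in> D. x [^] Q = h})" for h
  define u where "u = U \<one>"
  let ?N = "{x \<in> carrier G. x [^] a = \<one>}" and ?K = "{x \<in> carrier G. x [^] Q = \<one>}"
  have U0: "U h = 0" if "h \<in> carrier G - ?N" for h
  proof -
    have "x [^] Q \<in> ?N" if "x \<in> D" for x
      using that pow_order_eq_1[of x] ord by (simp add: nat_pow_pow mult.commute)
    then have "{x \<in> D. x [^] Q = h} = {}" using that by blast
    then show ?thesis unfolding U_def by (metis card.empty of_nat_0)
  qed
  have fN: "finite ?N" using finite_carrier by simp
  have sum_N: "(\<Sum>h\<in>carrier G. f (U h)) = f u + (\<Sum>h\<in>?N - {\<one>}. f (U h))" if "f 0 = 0" for f :: "int \<Rightarrow> int"
  proof -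
    have "(\<Sum>h\<in>carrier G. f (U h)) = (\<Sum>h\<in>?N. f (U h))"
      using finite_carrier U0 that by (intro sum.mono_neutral_right) auto
    also have "\<dots> = f u + (\<Sum>h\<in>?N - {\<one>}. f (U h))"
      unfolding u_def using fN by (intro sum.remove) auto
    finally show ?thesis .
  qed
  have s1: "(\<Sum>h\<in>?N - {\<one>}. U h) = k - u"
    using sum_N[of "\<lambda>x. x"] sum_power_fibre[of Q] by (simp add: U_def)
  define S where "S = (\<Sum>h\<in>?N - {\<one>}. U h ^ 2)"
  have "D \<inter> ?K = {x \<in> D. x [^] Q = \<one>}" by auto
  then have "u ^ 2 + S = k + mu * (int (card ?K) - 1) + (lam - mu) * u"
    using sum_N[of "\<lambda>x. x ^ 2"] sum_power_fibre_squares[of Q] by (simp add: U_def u_def S_def)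
  moreover have "mu * (int (card ?K) - 1) \<le> mu * (int Q - 1)" using KQ mu by (intro mult_left_mono) auto
  ultimately have s2: "u ^ 2 + S \<le> k + mu * (int Q - 1) + (lam - mu) * u" by simp
  define A where "A = int a - 1"
  have A: "A > 0" using a by (simp add: A_def)
  have "card (?N - {\<one>}) < card ?N" using fN by (intro card_Diff1_less) auto
  then have cN: "int (card (?N - {\<one>})) \<le> A" using Ka by (simp add: A_def)
  have cs: "(k - u) ^ 2 \<le> A * S"
  proof -
    \<comment> \<open>Cauchy-Schwarz from squared deviations: \<open>A\<close> bounds the number of
      nontrivial fibres, and one factor \<open>A\<close> is cancelled at the end.\<close>
    have "0 \<le> (\<Sum>h\<in>?N - {\<one>}. (A * U h - (k - u)) ^ 2)" by (intro sum_nonneg) auto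
    also have "\<dots> = (\<Sum>h\<in>?N - {\<one>}. A ^ 2 * U h ^ 2 - 2 * A * (k - u) * U h + (k - u) ^ 2)"
      by (intro sum.cong refl) (simp add: power2_eq_square algebra_simps)
    also have "\<dots> = A ^ 2 * S - 2 * A * (k - u) * (k - u) + int (card (?N - {\<one>})) * (k - u) ^ 2"
      by (simp add: sum.distrib sum_subtractf sum_distrib_left[symmetric] s1 S_def)
    also have "\<dots> \<le> A ^ 2 * S - 2 * A * (k - u) * (k - u) + A * (k - u) ^ 2"
      using cN by (intro add_left_mono mult_right_mono) auto
    also have "\<dots> = A * (A * S - (k - u) ^ 2)" by (simp add: power2_eq_square algebra_simps)
    finally show ?thesis using A by (simp add: zero_le_mult_iff)
  qed
  define X where "X = (A + 1) * u - k"
  have kk: "k ^ 2 = k + mu * ((A + 1) * int Q - 1) + (\<rho> + \<sigma>) * k"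
    using card_D_squared ord assms(1) by (simp add: A_def)
  have rs: "\<rho> * \<sigma> = mu - k" using assms(2) by simp
  have "(X - A * \<rho>) * (X - A * \<sigma>) = X ^ 2 - A * (\<rho> + \<sigma>) * X + A ^ 2 * (\<rho> * \<sigma>)"
    by (simp add: power2_eq_square algebra_simps)
  \<comment> \<open>The subtracted multiple of \<open>A\<close> vanishes by \<open>kk\<close>; what
    remains is the Cauchy-Schwarz defect.\<close>
  also have "\<dots> = (A + 1) * ((k - u) ^ 2 - A * (k + mu * (int Q - 1) + (\<rho> + \<sigma>) * u - u ^ 2))
      - A * (k ^ 2 - (k + mu * ((A + 1) * int Q - 1) + (\<rho> + \<sigma>) * k))"
    unfolding rs X_def by (simp add: power2_eq_square algebra_simps)
  also have "\<dots> = (A + 1) * ((k - u) ^ 2 - A * (k + mu * (int Q - 1) + (\<rho> + \<sigma>) * u - u ^ 2))"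
    unfolding kk by simp
  also have "\<dots> \<le> 0"
  proof -
    have "A * S \<le> A * (k + mu * (int Q - 1) + (\<rho> + \<sigma>) * u - u ^ 2)"
      using s2 A assms(1) by (intro mult_left_mono) auto
    then have "(k - u) ^ 2 \<le> A * (k + mu * (int Q - 1) + (\<rho> + \<sigma>) * u - u ^ 2)"
      using cs by (rule order_trans[rotated])
    then show ?thesis using A by (simp add: mult_le_0_iff)
  qed
  finally have prod: "(X - A * \<rho>) * (X - A * \<sigma>) \<le> 0" .
  have "A * \<sigma> < A * \<rho>" using A assms(3) by simp
  then have "X \<le> A * \<rho>" using prod by (smt (verit) mult_pos_pos)
  then show ?thesis by (simp add: X_def A_def u_def U_def)
qed

end

section \<open>Reduction to the symmetric case and the final contradiction\<close>

lemma pds_imp_symmetric_pds: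
  fixes G :: "('a, 'b) monoid_scheme"
  assumes "comm_group G" and pds: "pds G D v k lam mu" and "lam \<noteq> mu"
    and kk: "int k * (int k - 1) = lam * int k + mu * (int v - 1 - int k)"
  shows "symmetric_pds G D lam mu"
proof -
  interpret comm_group G by fact
  define N where "N g = {(x, y). x \<in> D \<and> y \<in> D \<and> x \<otimes>\<^bsub>G\<^esub> inv\<^bsub>G\<^esub> y = g}" for g
  have fin: "finite (carrier G)" and DG: "D \<subseteq> carrier G" and v: "card (carrier G) = v" and k: "card D = k"
    using pds by (auto simp: pds_def)
  have finD: "finite D" using DG fin by (rule finite_subset)
  have N: "int (card (N g)) = (if g \<in> D then lam else mu)" if g: "g \<in> carrier G" "g \<noteq> \<one>\<^bsub>G\<^esub>" for g
  proof -
    have "N g = {(x, y). x \<in> D \<and> y \<in> D \<and> x \<noteq> y \<and> x \<otimes>\<^bsub>G\<^esub> inv\<^bsub>G\<^esub> y = g}"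
      using g DG by (auto simp: N_def)
    then show ?thesis using pds g by (simp add: pds_def)
  qed
  have one: "\<one>\<^bsub>G\<^esub> \<notin> D"
  proof
    \<comment> \<open>Counting all pairs of distinct elements would give
      \<open>k * (k - 1) = lam * (k - 1) + mu * (v - k)\<close>; comparison with \<open>kk\<close>
      yields \<open>lam = mu\<close>.\<close>
    assume 1: "\<one>\<^bsub>G\<^esub> \<in> D"
    let ?C = "carrier G - {\<one>\<^bsub>G\<^esub>}" and ?S = "D \<times> D - (\<lambda>x. (x, x)) ` D"
    have ne: "x \<otimes>\<^bsub>G\<^esub> inv\<^bsub>G\<^esub> y = \<one>\<^bsub>G\<^esub> \<longleftrightarrow> x = y" if "x \<in> D" "y \<in> D" for x y
      using that DG by (metis inv_closed inv_equality inv_inv r_inv subsetD)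
    have "(\<Sum>g\<in>?C. \<Sum>z\<in>{z \<in> ?S. (\<lambda>(x, y). x \<otimes>\<^bsub>G\<^esub> inv\<^bsub>G\<^esub> y) z = g}. 1::int) = (\<Sum>z\<in>?S. 1)"
      using fin finD DG by (intro sum.group) (auto simp: ne image_iff subset_iff)
    moreover have "{z \<in> ?S. (\<lambda>(x, y). x \<otimes>\<^bsub>G\<^esub> inv\<^bsub>G\<^esub> y) z = g} = N g" if "g \<in> ?C" for g
      using that DG by (auto simp: N_def ne image_iff subset_iff)
    ultimately have "(\<Sum>g\<in>?C. int (card (N g))) = int (card ?S)" by simp
    also have "card ?S = k * k - k"
    proof -
      have "card ((\<lambda>x. (x, x)) ` D) = k" by (simp add: card_image inj_on_def k)
      then show ?thesis using finD k by (subst card_Diff_subset) (auto simp: card_cartesian_product)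
    qed
    also have "int (k * k - k) = int k * (int k - 1)"
      by (cases k) (auto simp: algebra_simps)
    also have "(\<Sum>g\<in>?C. int (card (N g))) = (\<Sum>g\<in>?C. if g \<in> D then lam else mu)"
      by (intro sum.cong refl N) auto
    also have "\<dots> = lam * int (card (?C \<inter> D)) + mu * int (card (?C - D))"
      using fin by (simp add: sum.If_cases Diff_eq)
    also have "card (?C \<inter> D) = k - 1"
    proof -
      have "?C \<inter> D = D - {\<one>\<^bsub>G\<^esub>}" using DG by auto
      then show ?thesis using 1 finD k by simp
    qed
    also have "card (?C - D) = v - k"
    proof -
      have "?C - D = carrier G - D" using 1 by auto
      then show ?thesis using finD DG k v by (simp add: card_Diff_subset)
    qed
    finally have "lam * int (k - 1) + mu * int (v - k) = int k * (int k - 1)" .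
    moreover have "k \<ge> 1" using 1 finD k by (metis One_nat_def Suc_leI card_gt_0_iff empty_iff)
    moreover have "k \<le> v" using card_mono[OF fin DG] v k by simp
    ultimately have "lam * (int k - 1) + mu * (int v - int k) = int k * (int k - 1)"
      by (simp add: of_nat_diff)
    then show False using kk assms(3) by (simp add: algebra_simps)
  qed
  have inv: "inv\<^bsub>G\<^esub> g \<in> D" if "g \<in> D" for g
  proof -
    have g: "g \<in> carrier G" "g \<noteq> \<one>\<^bsub>G\<^esub>" using that DG one by auto
    \<comment> \<open>Swapping a pair inverts its difference, so \<open>g\<close> and its inverse
      have equal counts. As \<open>lam \<noteq> mu\<close>, membership in \<open>D\<close> agrees
      too.\<close>
    have "N (inv\<^bsub>G\<^esub> h) = prod.swap ` N h" if "h \<in> carrier G" for h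
    proof -
      have sub: "prod.swap ` N h \<subseteq> N (inv\<^bsub>G\<^esub> h)" if "h \<in> carrier G" for h
        using DG by (auto simp: N_def inv_mult subset_iff m_comm)
      have "N (inv\<^bsub>G\<^esub> h) = prod.swap ` prod.swap ` N (inv\<^bsub>G\<^esub> h)" by (simp add: image_image)
      also have "\<dots> \<subseteq> prod.swap ` N h"
        using sub[of "inv\<^bsub>G\<^esub> h"] that by (intro image_mono) auto
      finally show ?thesis using sub[OF that] by blast
    qed
    then have "card (N (inv\<^bsub>G\<^esub> g)) = card (N g)" using g by (simp add: card_image)
    moreover have "inv\<^bsub>G\<^esub> g \<noteq> \<one>\<^bsub>G\<^esub>" using g by simp
    ultimately show ?thesis using N[of g] N[of "inv\<^bsub>G\<^esub> g"] g that assms(3) by (auto split: if_splits)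
  qed
  show ?thesis
    by unfold_locales (use fin DG one inv N in \<open>auto simp: N_def\<close>)
qed

theorem theorem7:
  fixes G :: "('a, 'b) monoid_scheme" and p s :: nat and r :: int
  assumes "comm_group G" and "finite (carrier G)"
    and "card (carrier G) = 9 * p ^ (4 * s)"
    and "prime p" and "p mod 4 = 1"
    and "odd s" and "s > 0"
    and "4 * r = 3 * int p ^ (2 * s) - 3 \<or> 4 * r = 3 * int p ^ (2 * s) + 5"
  shows "\<not> (\<exists>D. pds G D (9 * p ^ (4 * s)) (nat (r * (3 * int p ^ (2 * s) + 1)))
                 (- 3 * int p ^ (2 * s) + r ^ 2 + 3 * r) (r ^ 2 + r))"
proof
  define q Q where "q = int p ^ (2 * s)" and "Q = p ^ (4 * s)"
  define lam mu where "lam = - 3 * q + r ^ 2 + 3 * r" and "mu = r ^ 2 + r"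
  assume "\<exists>D. pds G D (9 * p ^ (4 * s)) (nat (r * (3 * int p ^ (2 * s) + 1)))
                 (- 3 * int p ^ (2 * s) + r ^ 2 + 3 * r) (r ^ 2 + r)"
  then obtain D where pds: "pds G D (9 * Q) (nat (r * (3 * q + 1))) lam mu"
    by (auto simp: q_def Q_def lam_def mu_def)
  have Qq: "int Q = q ^ 2" by (simp add: q_def Q_def power_mult[symmetric])
  have p5: "p \<ge> 5"
  proof (rule ccontr)
    assume "\<not> p \<ge> 5"
    then have "p \<in> {0, 1, 2, 3, 4}" by auto
    then show False using assms(4,5) by auto
  qed
  have p3: "coprime 9 Q"
  proof -
    have "coprime 3 p" using assms(4) p5 by (intro primes_coprime) auto
    then have "coprime 3 Q" by (simp add: Q_def)
    then have "coprime (3 * 3) Q" by (simp only: coprime_mult_left_iff simp_thms)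
    then show ?thesis by simp
  qed
  have "(5::int) ^ 2 \<le> int p ^ 2" using p5 by (intro power_mono) auto
  also have "\<dots> \<le> int p ^ (2 * s)" using assms(7) p5 by (intro power_increasing) auto
  finally have q25: "q \<ge> 25" by (simp add: q_def)
  have r_cases: "3 * q = 4 * r + 3 \<or> 3 * q = 4 * r - 5" using assms(8) by (auto simp: q_def)
  then have r: "r \<ge> 18" "r < 3 * q" using q25 by auto
  have k0: "r * (3 * q + 1) \<ge> 0" using r q25 by simp
  interpret symmetric_pds G D lam mu
  proof (rule pds_imp_symmetric_pds[OF assms(1) pds])
    \<comment> \<open>\<open>lam - mu = 2 * r - 3 * q\<close> is \<open>- 2 * r - 3\<close> or
      \<open>5 - 2 * r\<close>.\<close>
    show "lam \<noteq> mu" using r_cases r by (auto simp: lam_def mu_def)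
    have "int (nat (r * (3 * q + 1))) = r * (3 * q + 1)" using k0 by simp
    then show "int (nat (r * (3 * q + 1))) * (int (nat (r * (3 * q + 1))) - 1)
      = lam * int (nat (r * (3 * q + 1))) + mu * (int (9 * Q) - 1 - int (nat (r * (3 * q + 1))))"
      by (simp add: Qq lam_def mu_def power2_eq_square algebra_simps)
  qed
  have k: "k = r * (3 * q + 1)" using pds k0 by (simp add: pds_def)
  have ord: "order G = 9 * Q" using assms(3) by (simp add: order_def Q_def)
  define \<sigma> where "\<sigma> = r - 3 * q"
  have roots: "lam - mu = r + \<sigma>" "k - mu = - (r * \<sigma>)" "\<sigma> < r"
    using q25 by (auto simp: k lam_def mu_def \<sigma>_def power2_eq_square algebra_simps)
  have mu0: "mu \<ge> 0" using r by (simp add: mu_def)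
  have mult: "d [^]\<^bsub>G\<^esub> t \<in> D" if "coprime t (order G)" "t > 0" "d \<in> D" for t d
  proof (rule multiplier[OF roots(1,2) _ that])
    \<comment> \<open>The eigenvalues differ by \<open>3 * q\<close>, whose square is the group
      order.\<close>
    fix l :: nat assume l: "prime l" "int l dvd r - \<sigma>"
    have "int l dvd (r - \<sigma>) ^ 2" using l(2) by (simp add: power2_eq_square)
    also have "(r - \<sigma>) ^ 2 = int (order G)" by (simp add: ord Qq \<sigma>_def power2_eq_square)
    finally show "l dvd order G" by simp
  qed
  have dvd3: "3 dvd int (card {d \<in> D. d [^]\<^bsub>G\<^esub> (9::nat) = h})"
    if "h \<in> carrier G" "h \<noteq> \<one>\<^bsub>G\<^esub>" for h
    by (rule ninth_power_fibre_dvd[OF roots(1,2) _ _ that]) (auto simp: \<sigma>_def k algebra_simps)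
  obtain P where P: "subgroup P G" "card P = Q"
    using sylow_thm[of p G "4 * s" 9] assms ord is_group by (auto simp: Q_def mult.commute)
  obtain T where T: "subgroup T G" "card T = 9"
    using sylow_thm[of 3 G 2 Q] assms ord is_group by auto
  have K9: "card {x \<in> carrier G. x [^]\<^bsub>G\<^esub> (9::nat) = \<one>\<^bsub>G\<^esub>} \<le> 9"
    using card_power_kernel_le[OF finite_carrier ord p3 P] by simp
  have KQ: "card {x \<in> carrier G. x [^]\<^bsub>G\<^esub> Q = \<one>\<^bsub>G\<^esub>} \<le> Q"
    using card_power_kernel_le[OF finite_carrier _ _ T, of Q] ord p3 by (simp add: mult.commute coprime_commute)
  define d where "d = int (card {x \<in> D. x [^]\<^bsub>G\<^esub> (9::nat) = \<one>\<^bsub>G\<^esub>})"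
  have d0: "d \<ge> 0" by (simp add: d_def)
  have "6 * (k - d) - (k + 8 * mu + (lam - mu) * d - d ^ 2)
      \<le> 9 * int (card {x \<in> D. x [^]\<^bsub>G\<^esub> Q = \<one>\<^bsub>G\<^esub>})"
    unfolding d_def by (rule kernel_intersection_lower[OF mult ord p3 dvd3 K9 mu0])
  also have "\<dots> \<le> k + 8 * r"
    using kernel_intersection_upper[OF roots ord _ mu0 K9 KQ] by simp
  \<comment> \<open>The two bounds eliminate the intersection with the Sylow
    \<open>p\<close>-subgroup, leaving only \<open>d\<close> unknown. For both values of
    \<open>r\<close> the left side is positive for all \<open>d \<ge> 0\<close>, since
    \<open>r \<ge> 18\<close>.\<close>
  finally have ineq: "4 * r * (3 * q - 2 * r - 3) + d ^ 2 - 6 * d + (3 * q - 2 * r) * d \<le> 0"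
    by (simp add: k lam_def mu_def power2_eq_square algebra_simps)
  show False
    using r_cases
  proof
    assume m: "3 * q = 4 * r + 3"
    have "4 * r * (3 * q - 2 * r - 3) + d ^ 2 - 6 * d + (3 * q - 2 * r) * d = 8 * r ^ 2 + 2 * (r - 2) * d + d ^ 2 + d"
      unfolding m by (simp add: power2_eq_square algebra_simps)
    moreover have "8 * r ^ 2 > 0" "2 * (r - 2) * d \<ge> 0" using r d0 by auto
    ultimately show False using ineq d0 by (smt (verit) zero_le_power2)
  next
    assume m: "3 * q = 4 * r - 5"
    have "4 * r * (3 * q - 2 * r - 3) + d ^ 2 - 6 * d + (3 * q - 2 * r) * d
        = 8 * r * (r - 4) + (2 * r - 11) * d + d ^ 2"
      unfolding m by (simp add: power2_eq_square algebra_simps)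
    moreover have "8 * r * (r - 4) > 0" "(2 * r - 11) * d \<ge> 0" using r d0 by auto
    ultimately show False using ineq by (smt (verit) zero_le_power2)
  qed
qed

end
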